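(* Let $b\in\mathbb{R}\setminus\{0\}$, $\varphi:\mathbb{R}\to\mathbb{R}$, $\varphi(x)=x+b$, and let $\psi\in C^\infty(\mathbb{R})$ be a (complex) polynomial. Then $C_{\psi,\varphi}$ is power bounded on $\mathscr{S}(\mathbb{R})$ if and only if there is $c\in\mathbb{C}$, $|c|<1$, such that $\psi(x)=c$ for all $x\in\mathbb{R}$. In this case, the sequence $(C_{\psi,\varphi}^n)_{n\in\mathbb{N}}$ is convergent to $0$ in $\mathcal{L}_b(\mathscr{S}(\mathbb{R}))$.
   Context: $\mathscr{S}(\mathbb{R})$ is the Schwartz space of complex-valued rapidly decreasing smooth functions with its standard Fréchet topology. $C_{\psi,\varphi}f=\psi\cdot(f\circ\varphi)$. A continuous linear operator $T$ on a locally convex space $E$ is power bounded if $\{T^n:n\in\mathbb{N}\}$ is equicontinuous. $\mathcal{L}_b(E)$ is the space of continuous linear operators on $E$ with the topology of uniform convergence on bounded subsets of $E$. *)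

theory Defs
  imports "HOL-Analysis.Analysis" "HOL-Computational_Algebra.Polynomial"
begin

section \<open>Function spaces with a linear topology\<close>

text \<open>
  A locally convex space of complex-valued functions is given by a topology \<open>E\<close> whose
  carrier \<^term>\<open>topspace E\<close> is a linear subspace of \<open>'x \<Rightarrow> complex\<close> (with pointwise operations).
  An operator on it is a HOL function of which only the values on \<^term>\<open>topspace E\<close> matter.
\<close>

definition nhd0 :: "('x \<Rightarrow> complex) topology \<Rightarrow> ('x \<Rightarrow> complex) set \<Rightarrow> bool" where
  "nhd0 E V \<longleftrightarrow> openin E V \<and> (\<lambda>x. 0) \<in> V"

definition clinear_map_on ::
  "('x \<Rightarrow> complex) set \<Rightarrow> (('x \<Rightarrow> complex) \<Rightarrow> ('x \<Rightarrow> complex)) \<Rightarrow> bool" where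
  "clinear_map_on S T \<longleftrightarrow>
     (\<forall>f\<in>S. \<forall>g\<in>S. T (\<lambda>x. f x + g x) = (\<lambda>x. T f x + T g x)) \<and>
     (\<forall>c. \<forall>f\<in>S. T (\<lambda>x. c * f x) = (\<lambda>x. c * T f x))"

definition continuous_operator ::
  "('x \<Rightarrow> complex) topology \<Rightarrow> (('x \<Rightarrow> complex) \<Rightarrow> ('x \<Rightarrow> complex)) \<Rightarrow> bool" where
  "continuous_operator E T \<longleftrightarrow> continuous_map E E T \<and> clinear_map_on (topspace E) T"

text \<open>Equicontinuity at every point, with respect to the translation-invariant uniformity of \<open>E\<close>.\<close>

definition equicontinuous_family ::
  "('x \<Rightarrow> complex) topology \<Rightarrow> (('x \<Rightarrow> complex) \<Rightarrow> ('x \<Rightarrow> complex)) set \<Rightarrow> bool" where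
  "equicontinuous_family E H \<longleftrightarrow>
     (\<forall>f\<in>topspace E. \<forall>V. nhd0 E V \<longrightarrow>
        (\<exists>U. nhd0 E U \<and>
          (\<forall>T\<in>H. \<forall>g\<in>topspace E. (\<lambda>x. g x - f x) \<in> U \<longrightarrow> (\<lambda>x. T g x - T f x) \<in> V)))"

definition power_bounded ::
  "('x \<Rightarrow> complex) topology \<Rightarrow> (('x \<Rightarrow> complex) \<Rightarrow> ('x \<Rightarrow> complex)) \<Rightarrow> bool" where
  "power_bounded E T \<longleftrightarrow> continuous_operator E T \<and> equicontinuous_family E {T ^^ n | n. True}"

definition bounded_subset :: "('x \<Rightarrow> complex) topology \<Rightarrow> ('x \<Rightarrow> complex) set \<Rightarrow> bool" where
  "bounded_subset E B \<longleftrightarrow> B \<subseteq> topspace E \<and>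
     (\<forall>V. nhd0 E V \<longrightarrow>
        (\<exists>r>0. \<forall>c. cmod c \<ge> r \<longrightarrow> B \<subseteq> (\<lambda>f x. c * f x) ` V))"


section \<open>The operator space with uniform convergence on bounded sets\<close>

text \<open>Operators are taken extensional on the carrier, so that each one is represented once.\<close>

definition operators ::
  "('x \<Rightarrow> complex) topology \<Rightarrow> (('x \<Rightarrow> complex) \<Rightarrow> ('x \<Rightarrow> complex)) set" where
  "operators E = {T \<in> extensional (topspace E). continuous_operator E T}"

text \<open>
  The sets \<open>{R. \<forall>f\<in>B. R f - T f \<in> V}\<close>, for \<open>B\<close> bounded and \<open>V\<close> a neighbourhood of zero, form a
  neighbourhood base at \<open>T\<close>. They need not be open, so they cannot serve as a subbase.
\<close>

definition openin_Lb ::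
  "('x \<Rightarrow> complex) topology \<Rightarrow> (('x \<Rightarrow> complex) \<Rightarrow> ('x \<Rightarrow> complex)) set \<Rightarrow> bool" where
  "openin_Lb E W \<longleftrightarrow> W \<subseteq> operators E \<and>
     (\<forall>T\<in>W. \<exists>B V. bounded_subset E B \<and> nhd0 E V \<and>
        {R \<in> operators E. \<forall>f\<in>B. (\<lambda>x. R f x - T f x) \<in> V} \<subseteq> W)"

definition Lb_topology ::
  "('x \<Rightarrow> complex) topology \<Rightarrow> (('x \<Rightarrow> complex) \<Rightarrow> ('x \<Rightarrow> complex)) topology" where
  "Lb_topology E = topology (openin_Lb E)"

lemma bounded_subset_Un:
  assumes "bounded_subset E A" "bounded_subset E B"
  shows "bounded_subset E (A \<union> B)"
  unfolding bounded_subset_def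
proof (intro conjI allI impI)
  show "A \<union> B \<subseteq> topspace E"
    using assms by (auto simp: bounded_subset_def)
next
  fix V assume "nhd0 E V"
  then obtain r s where r: "r > 0" "\<And>c. cmod c \<ge> r \<Longrightarrow> A \<subseteq> (\<lambda>f x. c * f x) ` V"
    and s: "s > 0" "\<And>c. cmod c \<ge> s \<Longrightarrow> B \<subseteq> (\<lambda>f x. c * f x) ` V"
    using assms unfolding bounded_subset_def by meson
  show "\<exists>r>0. \<forall>c. cmod c \<ge> r \<longrightarrow> A \<union> B \<subseteq> (\<lambda>f x. c * f x) ` V"
  proof (intro exI[of _ "max r s"] conjI allI impI)
    show "max r s > 0" using r(1) by simp
    fix c assume "cmod c \<ge> max r s"
    then show "A \<union> B \<subseteq> (\<lambda>f x. c * f x) ` V"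
      using r(2)[of c] s(2)[of c] by simp
  qed
qed

lemma nhd0_Int: "nhd0 E U \<Longrightarrow> nhd0 E V \<Longrightarrow> nhd0 E (U \<inter> V)"
  by (auto simp: nhd0_def)

lemma istopology_openin_Lb: "istopology (openin_Lb E)"
  unfolding istopology_def
proof (intro conjI allI impI)
  fix W W' assume W: "openin_Lb E W" and W': "openin_Lb E W'"
  show "openin_Lb E (W \<inter> W')"
    unfolding openin_Lb_def
  proof (intro conjI ballI)
    show "W \<inter> W' \<subseteq> operators E" using W by (auto simp: openin_Lb_def)
    fix T assume T: "T \<in> W \<inter> W'"
    obtain B V where 1: "bounded_subset E B" "nhd0 E V"
      "{R \<in> operators E. \<forall>f\<in>B. (\<lambda>x. R f x - T f x) \<in> V} \<subseteq> W"
      using W T unfolding openin_Lb_def by (meson IntD1)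
    obtain B' V' where 2: "bounded_subset E B'" "nhd0 E V'"
      "{R \<in> operators E. \<forall>f\<in>B'. (\<lambda>x. R f x - T f x) \<in> V'} \<subseteq> W'"
      using W' T unfolding openin_Lb_def by (meson IntD2)
    have "{R \<in> operators E. \<forall>f\<in>B \<union> B'. (\<lambda>x. R f x - T f x) \<in> V \<inter> V'} \<subseteq> W \<inter> W'"
      using 1(3) 2(3) by blast
    then show "\<exists>B V. bounded_subset E B \<and> nhd0 E V \<and>
        {R \<in> operators E. \<forall>f\<in>B. (\<lambda>x. R f x - T f x) \<in> V} \<subseteq> W \<inter> W'"
      using bounded_subset_Un[OF 1(1) 2(1)] nhd0_Int[OF 1(2) 2(2)] by (intro exI conjI)
  qed
next
  fix \<K> assume K: "\<forall>W\<in>\<K>. openin_Lb E W"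
  show "openin_Lb E (\<Union>\<K>)"
    unfolding openin_Lb_def
  proof (intro conjI ballI)
    show "\<Union>\<K> \<subseteq> operators E" using K by (auto simp: openin_Lb_def)
    fix T assume "T \<in> \<Union>\<K>"
    then obtain W where W: "W \<in> \<K>" "T \<in> W" by blast
    then obtain B V where "bounded_subset E B" "nhd0 E V"
      "{R \<in> operators E. \<forall>f\<in>B. (\<lambda>x. R f x - T f x) \<in> V} \<subseteq> W"
      using K unfolding openin_Lb_def by meson
    with W(1) show "\<exists>B V. bounded_subset E B \<and> nhd0 E V \<and>
        {R \<in> operators E. \<forall>f\<in>B. (\<lambda>x. R f x - T f x) \<in> V} \<subseteq> \<Union>\<K>"
      by (meson Union_upper order_trans)
  qed
qed

lemma openin_Lb_topology: "openin (Lb_topology E) = openin_Lb E"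
  by (simp add: Lb_topology_def istopology_openin_Lb)


section \<open>The Schwartz space\<close>

definition nderiv :: "nat \<Rightarrow> (real \<Rightarrow> complex) \<Rightarrow> (real \<Rightarrow> complex)" where
  "nderiv j = (\<lambda>f x. vector_derivative f (at x)) ^^ j"

definition smooth :: "(real \<Rightarrow> complex) \<Rightarrow> bool" where
  "smooth f \<longleftrightarrow> (\<forall>j x. nderiv j f differentiable (at x))"

definition schwartz_space :: "(real \<Rightarrow> complex) set" where
  "schwartz_space =
     {f. smooth f \<and> (\<forall>k j. bounded (range (\<lambda>x. complex_of_real (x ^ k) * nderiv j f x)))}"

definition schwartz_seminorm :: "nat \<Rightarrow> nat \<Rightarrow> (real \<Rightarrow> complex) \<Rightarrow> real" where
  "schwartz_seminorm k j f = (SUP x. \<bar>x\<bar> ^ k * cmod (nderiv j f x))"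

definition schwartz :: "(real \<Rightarrow> complex) topology" where
  "schwartz = topology_generated_by
     {{g \<in> schwartz_space. schwartz_seminorm k j (\<lambda>x. g x - f x) < e} | f k j e.
        f \<in> schwartz_space \<and> e > 0}"

lemma topspace_schwartz: "topspace schwartz = schwartz_space"
proof -
  have zero: "nderiv j (\<lambda>x. 0) = (\<lambda>x. 0)" for j
    by (induction j) (simp_all add: nderiv_def)
  have "f \<in> {g \<in> schwartz_space. schwartz_seminorm 0 0 (\<lambda>x. g x - f x) < 1}"
    if "f \<in> schwartz_space" for f
    using that by (simp add: schwartz_seminorm_def zero)
  moreover have "{g \<in> schwartz_space. schwartz_seminorm 0 0 (\<lambda>x. g x - f x) < 1} \<in>
      {{g \<in> schwartz_space. schwartz_seminorm k j (\<lambda>x. g x - f x) < e} | f k j e.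
        f \<in> schwartz_space \<and> e > 0}" if "f \<in> schwartz_space" for f
    using that
    by (intro CollectI exI[of _ f] exI[of _ "0::nat"] exI[of _ "1::real"] conjI refl zero_less_one)
  ultimately have "schwartz_space \<subseteq> topspace schwartz"
    unfolding schwartz_def topology_generated_by_topspace by (meson UnionI subsetI)
  moreover have "topspace schwartz \<subseteq> schwartz_space"
    unfolding schwartz_def topology_generated_by_topspace by (rule Union_least) auto
  ultimately show ?thesis by (rule equalityI[rotated])
qed


section \<open>Weighted composition operators\<close>

definition weighted_comp ::
  "(real \<Rightarrow> complex) \<Rightarrow> (real \<Rightarrow> real) \<Rightarrow> (real \<Rightarrow> complex) \<Rightarrow> (real \<Rightarrow> complex)" where
  "weighted_comp \<psi> \<phi> f = (\<lambda>x. \<psi> x * f (\<phi> x))"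

end

theory Submission
  imports Defs "HOL-Computational_Algebra.Fundamental_Theorem_Algebra"
begin

text \<open>
  For constant \<open>\<psi> = c\<close> the powers are \<open>c ^ n * f (x + n * b)\<close>, whose seminorms are those of \<open>f\<close>
  up to a factor polynomial in \<open>n\<close> times \<open>\<bar>c\<bar> ^ n\<close>; this factor tends to zero when \<open>\<bar>c\<bar> < 1\<close>.
  Conversely, if \<open>\<psi>\<close> is any other polynomial, then there is a point \<open>y\<close> with
  \<open>\<bar>\<psi> (y - i * b)\<bar> \<ge> 1\<close> for all \<open>i \<ge> 1\<close>. For the Gaussian \<open>g\<close>, the value of
  \<open>\<bar>x * (C ^ n g) x\<bar>\<close> at \<open>x = y - n * b\<close> is then at least \<open>\<bar>y - n * b\<bar> * g y\<close>. So already the orbit of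
  this one function is unbounded.
\<close>

section \<open>Iterated derivatives and seminorms\<close>

lemma nderiv_0 [simp]: "nderiv 0 f = f"
  by (simp add: nderiv_def)

lemma nderiv_Suc: "nderiv (Suc j) f = (\<lambda>x. vector_derivative (nderiv j f) (at x))"
  by (simp add: nderiv_def)

lemma has_vector_derivative_nderiv:
  "smooth f \<Longrightarrow> (nderiv j f has_vector_derivative nderiv (Suc j) f x) (at x)"
  by (simp add: smooth_def nderiv_Suc vector_derivative_works)

text \<open>By uniqueness of derivatives, a guessed sequence \<open>D\<close> in which each member
  differentiates to the next must be the sequence of iterated derivatives. Sums, shifts and the
  Gaussian are all handled by exhibiting such a \<open>D\<close>; \<open>smoothI\<close> is the
  companion for smoothness.\<close>

lemma nderiv_eqI:
  assumes "\<And>j x. (D j has_vector_derivative D (Suc j) x) (at x)"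
  shows "nderiv j (D 0) = D j"
  using assms by (induction j) (auto simp: nderiv_Suc vector_derivative_at)

lemma smoothI:
  assumes "\<And>j x. (D j has_vector_derivative D (Suc j) x) (at x)"
  shows "smooth (D 0)"
  using assms unfolding smooth_def nderiv_eqI[of D, OF assms]
  by (blast intro: differentiableI_vector)

lemma
  assumes "smooth f" "smooth g"
  shows nderiv_add: "nderiv j (\<lambda>x. f x + g x) = (\<lambda>x. nderiv j f x + nderiv j g x)"
    and smooth_add: "smooth (\<lambda>x. f x + g x)"
proof -
  have *: "((\<lambda>x. nderiv j f x + nderiv j g x) has_vector_derivative
      nderiv (Suc j) f x + nderiv (Suc j) g x) (at x)" for j x
    by (intro has_vector_derivative_add has_vector_derivative_nderiv assms)
  show "nderiv j (\<lambda>x. f x + g x) = (\<lambda>x. nderiv j f x + nderiv j g x)"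
    using nderiv_eqI[of "\<lambda>j x. nderiv j f x + nderiv j g x", OF *] by simp
  show "smooth (\<lambda>x. f x + g x)"
    using smoothI[of "\<lambda>j x. nderiv j f x + nderiv j g x", OF *] by simp
qed

lemma
  assumes "smooth f"
  shows nderiv_shift: "nderiv j (\<lambda>x. a * f (x + t)) = (\<lambda>x. a * nderiv j f (x + t))"
    and smooth_shift: "smooth (\<lambda>x. a * f (x + t))"
proof -
  have *: "((\<lambda>x. a * nderiv j f (x + t)) has_vector_derivative
      a * nderiv (Suc j) f (x + t)) (at x)" for j x
  proof -
    have "((\<lambda>x. x + t) has_vector_derivative 1) (at x)"
      by (auto intro!: derivative_eq_intros)
    from vector_diff_chain_at[OF this has_vector_derivative_nderiv[OF assms, of j]]
    have "((\<lambda>x. nderiv j f (x + t)) has_vector_derivative nderiv (Suc j) f (x + t)) (at x)"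
      by (simp add: o_def)
    then show ?thesis
      by (rule has_vector_derivative_mult_right)
  qed
  show "nderiv j (\<lambda>x. a * f (x + t)) = (\<lambda>x. a * nderiv j f (x + t))"
    using nderiv_eqI[of "\<lambda>j x. a * nderiv j f (x + t)", OF *] by simp
  show "smooth (\<lambda>x. a * f (x + t))"
    using smoothI[of "\<lambda>j x. a * nderiv j f (x + t)", OF *] by simp
qed

section \<open>Membership in the Schwartz space and estimates of its seminorms\<close>

lemma schwartz_space_iff:
  "f \<in> schwartz_space \<longleftrightarrow> smooth f \<and> (\<forall>k j. \<exists>B. \<forall>x. \<bar>x\<bar> ^ k * cmod (nderiv j f x) \<le> B)"
  by (simp add: schwartz_space_def bounded_iff norm_mult norm_power)

lemma schwartz_space_smooth: "f \<in> schwartz_space \<Longrightarrow> smooth f"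
  by (simp add: schwartz_space_iff)

lemma le_schwartz_seminorm:
  assumes "f \<in> schwartz_space"
  shows "\<bar>x\<bar> ^ k * cmod (nderiv j f x) \<le> schwartz_seminorm k j f"
proof -
  obtain B where "\<And>x. \<bar>x\<bar> ^ k * cmod (nderiv j f x) \<le> B"
    using assms unfolding schwartz_space_iff by blast
  then have "bdd_above (range (\<lambda>x. \<bar>x\<bar> ^ k * cmod (nderiv j f x)))"
    by (intro bdd_aboveI2)
  then show ?thesis
    unfolding schwartz_seminorm_def by (intro cSUP_upper) auto
qed

lemma schwartz_seminorm_le:
  "(\<And>x. \<bar>x\<bar> ^ k * cmod (nderiv j f x) \<le> B) \<Longrightarrow> schwartz_seminorm k j f \<le> B"
  unfolding schwartz_seminorm_def by (intro cSUP_least) auto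

lemma schwartz_seminorm_nonneg: "f \<in> schwartz_space \<Longrightarrow> 0 \<le> schwartz_seminorm k j f"
  by (rule order_trans[OF _ le_schwartz_seminorm[of f 0]]) auto

lemma
  assumes "f \<in> schwartz_space" "g \<in> schwartz_space"
  shows schwartz_space_add: "(\<lambda>x. f x + g x) \<in> schwartz_space"
    and schwartz_seminorm_add:
      "schwartz_seminorm k j (\<lambda>x. f x + g x) \<le> schwartz_seminorm k j f + schwartz_seminorm k j g"
proof -
  have *: "\<bar>x\<bar> ^ k * cmod (nderiv j (\<lambda>x. f x + g x) x)
      \<le> schwartz_seminorm k j f + schwartz_seminorm k j g" for k j x
  proof -
    have "\<bar>x\<bar> ^ k * cmod (nderiv j (\<lambda>x. f x + g x) x)
        \<le> \<bar>x\<bar> ^ k * (cmod (nderiv j f x) + cmod (nderiv j g x))"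
      using assms by (intro mult_left_mono)
        (auto simp: nderiv_add schwartz_space_smooth norm_triangle_ineq)
    also have "\<dots> \<le> schwartz_seminorm k j f + schwartz_seminorm k j g"
      unfolding distrib_left by (intro add_mono le_schwartz_seminorm assms)
    finally show ?thesis .
  qed
  show "(\<lambda>x. f x + g x) \<in> schwartz_space"
    using assms * by (auto simp: schwartz_space_iff smooth_add)
  show "schwartz_seminorm k j (\<lambda>x. f x + g x) \<le> schwartz_seminorm k j f + schwartz_seminorm k j g"
    by (intro schwartz_seminorm_le *)
qed

text \<open>The quantitative core of the constant case. Translation commutes with differentiation,
  so only the weight \<bar>x\<bar>^k has to be compared with its value at \<open>x + t\<close>. The
  cost grows like \<bar>t\<bar>^k, with an exponent that does not depend on \<open>j\<close> or
  \<open>f\<close>.\<close>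

lemma
  assumes "f \<in> schwartz_space"
  shows schwartz_space_shift: "(\<lambda>x. a * f (x + t)) \<in> schwartz_space"
    and schwartz_seminorm_shift: "schwartz_seminorm k j (\<lambda>x. a * f (x + t))
      \<le> cmod a * 2 ^ k * (1 + \<bar>t\<bar> ^ k) * (schwartz_seminorm k j f + schwartz_seminorm 0 j f)"
proof -
  have *: "\<bar>x\<bar> ^ k * cmod (nderiv j (\<lambda>x. a * f (x + t)) x)
      \<le> cmod a * 2 ^ k * (1 + \<bar>t\<bar> ^ k) * (schwartz_seminorm k j f + schwartz_seminorm 0 j f)"
    for k j x
  proof -
    let ?y = "x + t" and ?d = "cmod (nderiv j f (x + t))"
    have "\<bar>x\<bar> \<le> 2 * max \<bar>?y\<bar> \<bar>t\<bar>"
      by (simp add: max_def abs_if)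
    then have "\<bar>x\<bar> ^ k \<le> (2 * max \<bar>?y\<bar> \<bar>t\<bar>) ^ k"
      by (intro power_mono) auto
    also have "\<dots> = 2 ^ k * (max \<bar>?y\<bar> \<bar>t\<bar>) ^ k"
      by (simp add: power_mult_distrib)
    also have "\<dots> \<le> 2 ^ k * (\<bar>?y\<bar> ^ k + \<bar>t\<bar> ^ k)"
      by (intro mult_left_mono) (auto simp: max_def)
    finally have "\<bar>x\<bar> ^ k * (cmod a * ?d) \<le> 2 ^ k * (\<bar>?y\<bar> ^ k + \<bar>t\<bar> ^ k) * (cmod a * ?d)"
      by (intro mult_right_mono) auto
    \<comment> \<open>The trivial factor \<open>\<bar>?y\<bar> ^ 0\<close> puts the second summand
      into the form bounded by the unweighted seminorm with \<open>k = 0\<close>.\<close>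
    also have "\<dots> = cmod a * 2 ^ k * (\<bar>?y\<bar> ^ k * ?d + \<bar>t\<bar> ^ k * (\<bar>?y\<bar> ^ 0 * ?d))"
      by (simp add: algebra_simps)
    also have "\<dots> \<le> cmod a * 2 ^ k *
        (schwartz_seminorm k j f + \<bar>t\<bar> ^ k * schwartz_seminorm 0 j f)"
      by (intro mult_left_mono add_mono le_schwartz_seminorm assms) auto
    also have "\<dots> \<le> cmod a * 2 ^ k *
        ((1 + \<bar>t\<bar> ^ k) * (schwartz_seminorm k j f + schwartz_seminorm 0 j f))"
      using schwartz_seminorm_nonneg[OF assms, of k j] schwartz_seminorm_nonneg[OF assms, of 0 j]
      by (intro mult_left_mono) (auto simp: algebra_simps)
    finally show ?thesis
      using assms by (simp add: nderiv_shift schwartz_space_smooth norm_mult mult_ac)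
  qed
  show "(\<lambda>x. a * f (x + t)) \<in> schwartz_space"
    using assms * by (auto simp: schwartz_space_iff smooth_shift)
  show "schwartz_seminorm k j (\<lambda>x. a * f (x + t))
      \<le> cmod a * 2 ^ k * (1 + \<bar>t\<bar> ^ k) * (schwartz_seminorm k j f + schwartz_seminorm 0 j f)"
    by (intro schwartz_seminorm_le *)
qed

text \<open>Compared with \<open>schwartz_seminorm_shift\<close> at \<open>t = 0\<close>, the
  constant here is exactly \<open>cmod a\<close>, and no second seminorm appears.\<close>

lemma schwartz_seminorm_scale:
  assumes "f \<in> schwartz_space"
  shows "schwartz_seminorm k j (\<lambda>x. a * f x) \<le> cmod a * schwartz_seminorm k j f"
proof (rule schwartz_seminorm_le)
  fix x
  have "\<bar>x\<bar> ^ k * cmod (nderiv j (\<lambda>x. a * f x) x) = cmod a * (\<bar>x\<bar> ^ k * cmod (nderiv j f x))"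
    using nderiv_shift[OF schwartz_space_smooth[OF assms], of j a 0] by (simp add: norm_mult)
  also have "\<dots> \<le> cmod a * schwartz_seminorm k j f"
    by (intro mult_left_mono le_schwartz_seminorm assms) auto
  finally show "\<bar>x\<bar> ^ k * cmod (nderiv j (\<lambda>x. a * f x) x) \<le> cmod a * schwartz_seminorm k j f" .
qed

lemma schwartz_space_diff:
  assumes "f \<in> schwartz_space" "g \<in> schwartz_space"
  shows "(\<lambda>x. f x - g x) \<in> schwartz_space"
  using schwartz_space_add[OF assms(1) schwartz_space_shift[OF assms(2), of "-1" 0]] by simp

lemma schwartz_space_zero: "(\<lambda>x. 0) \<in> schwartz_space"
proof -
  have "nderiv j (\<lambda>x. 0) = (\<lambda>x. 0)" for j
    by (induction j) (simp_all add: nderiv_Suc)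
  then show ?thesis
    by (auto simp: schwartz_space_iff smooth_def)
qed

lemma schwartz_seminorm_zero [simp]: "schwartz_seminorm k j (\<lambda>x. 0) = 0"
  using schwartz_seminorm_scale[OF schwartz_space_zero, of k j 0]
    schwartz_seminorm_nonneg[OF schwartz_space_zero, of k j] by simp

section \<open>The topology of the Schwartz space\<close>

lemma openin_schwartz_ball:
  assumes "f \<in> schwartz_space" "e > 0"
  shows "openin schwartz {g \<in> schwartz_space. schwartz_seminorm k j (\<lambda>x. g x - f x) < e}"
proof -
  have "\<exists>f' k' j' e'. {g \<in> schwartz_space. schwartz_seminorm k j (\<lambda>x. g x - f x) < e} =
      {g \<in> schwartz_space. schwartz_seminorm k' j' (\<lambda>x. g x - f' x) < e'} \<and>
      f' \<in> schwartz_space \<and> e' > 0"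
    by (intro exI[of _ f] exI[of _ k] exI[of _ j] exI[of _ e] conjI refl assms)
  then show ?thesis
    unfolding schwartz_def by (intro topology_generated_by_Basis CollectI)
qed

text \<open>The generating sets bound one seminorm each and form only a subbase. Bounding all
  indices up to a common \<open>N\<close> yields a neighbourhood base, since two such conditions
  combine by taking the larger \<open>N\<close> and the smaller \<open>e\<close>.\<close>

lemma openin_schwartz_iff:
  "openin schwartz W \<longleftrightarrow> W \<subseteq> schwartz_space \<and>
    (\<forall>f\<in>W. \<exists>N. \<exists>e>0. \<forall>g\<in>schwartz_space.
       (\<forall>k\<le>N. \<forall>j\<le>N. schwartz_seminorm k j (\<lambda>x. g x - f x) < e) \<longrightarrow> g \<in> W)"
  (is "_ \<longleftrightarrow> _ \<and> ?P W")
proof (intro iffI conjI)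
  assume W: "openin schwartz W"
  show "W \<subseteq> schwartz_space"
    using openin_subset[OF W] by (simp add: topspace_schwartz)
  have "generate_topology_on
     {{g \<in> schwartz_space. schwartz_seminorm k j (\<lambda>x. g x - f x) < e} | f k j e.
        f \<in> schwartz_space \<and> e > 0} W"
    using W by (simp add: schwartz_def openin_topology_generated_by_iff)
  then show "?P W"
  proof induction
    case Empty
    then show ?case by simp
  next
    case (Int U V)
    show ?case
    proof
      fix f assume "f \<in> U \<inter> V"
      then have "f \<in> U" "f \<in> V" by auto
      obtain M d where d: "d > 0" "\<forall>g\<in>schwartz_space.
          (\<forall>k\<le>M. \<forall>j\<le>M. schwartz_seminorm k j (\<lambda>x. g x - f x) < d) \<longrightarrow> g \<in> U"
        using bspec[OF Int.IH(1) \<open>f \<in> U\<close>] by blast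
      obtain N e where e: "e > 0" "\<forall>g\<in>schwartz_space.
          (\<forall>k\<le>N. \<forall>j\<le>N. schwartz_seminorm k j (\<lambda>x. g x - f x) < e) \<longrightarrow> g \<in> V"
        using bspec[OF Int.IH(2) \<open>f \<in> V\<close>] by blast
      show "\<exists>N. \<exists>e>0. \<forall>g\<in>schwartz_space.
          (\<forall>k\<le>N. \<forall>j\<le>N. schwartz_seminorm k j (\<lambda>x. g x - f x) < e) \<longrightarrow> g \<in> U \<inter> V"
        using d e by (intro exI[of _ "max M N"] exI[of _ "min d e"]) auto
    qed
  next
    case (UN K)
    show ?case
    proof
      fix f assume "f \<in> \<Union>K"
      then obtain V where V: "V \<in> K" "f \<in> V" by blast
      then obtain N e where "e > 0" "\<forall>g\<in>schwartz_space.
          (\<forall>k\<le>N. \<forall>j\<le>N. schwartz_seminorm k j (\<lambda>x. g x - f x) < e) \<longrightarrow> g \<in> V"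
        using bspec[OF UN.IH[OF V(1)] V(2)] by blast
      then show "\<exists>N. \<exists>e>0. \<forall>g\<in>schwartz_space.
          (\<forall>k\<le>N. \<forall>j\<le>N. schwartz_seminorm k j (\<lambda>x. g x - f x) < e) \<longrightarrow> g \<in> \<Union>K"
        using V(1) by blast
    qed
  next
    case (Basis V)
    then obtain h k j e where h: "h \<in> schwartz_space" "e > 0"
      and V: "V = {g \<in> schwartz_space. schwartz_seminorm k j (\<lambda>x. g x - h x) < e}"
      by blast
    show ?case
    proof
      fix f assume "f \<in> V"
      then have f: "f \<in> schwartz_space" "schwartz_seminorm k j (\<lambda>x. f x - h x) < e"
        by (auto simp: V)
      \<comment> \<open>The ball is centred at \<open>h\<close>, not at \<open>f\<close>;
        \<open>?d\<close> is the room that the triangle inequality leaves around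
        \<open>f\<close>.\<close>
      let ?d = "e - schwartz_seminorm k j (\<lambda>x. f x - h x)"
      have "g \<in> V" if g: "g \<in> schwartz_space"
        and less: "\<forall>k'\<le>max k j. \<forall>j'\<le>max k j. schwartz_seminorm k' j' (\<lambda>x. g x - f x) < ?d" for g
      proof -
        have "schwartz_seminorm k j (\<lambda>x. g x - h x)
            \<le> schwartz_seminorm k j (\<lambda>x. g x - f x) + schwartz_seminorm k j (\<lambda>x. f x - h x)"
          using schwartz_seminorm_add[of "\<lambda>x. g x - f x" "\<lambda>x. f x - h x" k j] f g h
          by (simp add: schwartz_space_diff)
        also have "\<dots> < e"
          using less[rule_format, of k j] by simp
        finally show ?thesis
          using g by (simp add: V)
      qed
      then show "\<exists>N. \<exists>e>0. \<forall>g\<in>schwartz_space.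
          (\<forall>k\<le>N. \<forall>j\<le>N. schwartz_seminorm k j (\<lambda>x. g x - f x) < e) \<longrightarrow> g \<in> V"
        using f by (intro exI[of _ "max k j"] exI[of _ ?d]) auto
    qed
  qed
next
  assume R: "W \<subseteq> schwartz_space \<and> ?P W"
  show "openin schwartz W"
  proof (subst openin_subopen, intro ballI)
    fix f assume f: "f \<in> W"
    obtain N e where e: "e > 0"
      and sub: "\<forall>g\<in>schwartz_space.
        (\<forall>k\<le>N. \<forall>j\<le>N. schwartz_seminorm k j (\<lambda>x. g x - f x) < e) \<longrightarrow> g \<in> W"
      using bspec[OF conjunct2[OF R] f] by blast
    let ?ball = "\<lambda>(k, j). {g \<in> schwartz_space. schwartz_seminorm k j (\<lambda>x. g x - f x) < e}"
    \<comment> \<open>Only finitely many pairs of indices occur, so this intersection of subbasic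
      sets is open.\<close>
    let ?U = "\<Inter> (?ball ` ({..N} \<times> {..N}))"
    have "openin schwartz ?U"
    proof (rule openin_Inter)
      fix X assume "X \<in> ?ball ` ({..N} \<times> {..N})"
      then obtain k j
        where "X = {g \<in> schwartz_space. schwartz_seminorm k j (\<lambda>x. g x - f x) < e}"
        by auto
      then show "openin schwartz X"
        using openin_schwartz_ball[of f e] e f R by auto
    qed auto
    moreover have "f \<in> ?U"
      using e f R by auto
    moreover have "?U \<subseteq> W"
      using sub by auto
    ultimately show "\<exists>T. openin schwartz T \<and> f \<in> T \<and> T \<subseteq> W"
      by blast
  qed
qed

text \<open>Together with \<open>nhd0_schwartzE\<close> this replaces neighbourhoods of zero by
  finitely many seminorm inequalities.\<close>

lemma nhd0_schwartz_ball:
  assumes "e > 0"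
  shows "nhd0 schwartz {f \<in> schwartz_space. \<forall>k\<le>N. \<forall>j\<le>N. schwartz_seminorm k j f < e}"
proof -
  have "openin schwartz {f \<in> schwartz_space. schwartz_seminorm k j f < e}" for k j
    using openin_schwartz_ball[OF schwartz_space_zero assms, of k j] by simp
  then have "openin schwartz
      (\<Inter>(k, j)\<in>{..N} \<times> {..N}. {f \<in> schwartz_space. schwartz_seminorm k j f < e})"
    by (intro openin_Inter) auto
  moreover have "(\<Inter>(k, j)\<in>{..N} \<times> {..N}. {f \<in> schwartz_space. schwartz_seminorm k j f < e}) =
      {f \<in> schwartz_space. \<forall>k\<le>N. \<forall>j\<le>N. schwartz_seminorm k j f < e}"
    by auto
  ultimately show ?thesis
    using assms schwartz_space_zero by (simp add: nhd0_def)
qed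

lemma nhd0_schwartzE:
  assumes "nhd0 schwartz V"
  obtains N e where "e > 0" "\<And>f. f \<in> schwartz_space \<Longrightarrow>
    \<forall>k\<le>N. \<forall>j\<le>N. schwartz_seminorm k j f < e \<Longrightarrow> f \<in> V"
proof -
  have "openin schwartz V" "(\<lambda>x. 0) \<in> V"
    using assms by (auto simp: nhd0_def)
  then have "\<exists>N. \<exists>e>0. \<forall>g\<in>schwartz_space.
      (\<forall>k\<le>N. \<forall>j\<le>N. schwartz_seminorm k j (\<lambda>x. g x - 0) < e) \<longrightarrow> g \<in> V"
    unfolding openin_schwartz_iff by (elim conjE) (erule bspec)
  then obtain N e where "e > 0" "\<forall>g\<in>schwartz_space.
      (\<forall>k\<le>N. \<forall>j\<le>N. schwartz_seminorm k j g < e) \<longrightarrow> g \<in> V"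
    by auto
  then show thesis
    by (intro that[of e N]) auto
qed

text \<open>A bounded set is absorbed by the unit ball of the finitely many seminorms, and by
  homogeneity the absorbing radius is itself a common bound for these seminorms.\<close>

lemma bounded_subset_schwartzD:
  assumes "bounded_subset schwartz B"
  obtains M where "M > 0" "\<And>f. f \<in> B \<Longrightarrow> \<forall>k\<le>N. \<forall>j\<le>N. schwartz_seminorm k j f < M"
proof -
  let ?V = "{f \<in> schwartz_space. \<forall>k\<le>N. \<forall>j\<le>N. schwartz_seminorm k j f < 1}"
  have "nhd0 schwartz ?V"
    by (rule nhd0_schwartz_ball) simp
  then obtain r where r: "r > 0" "\<And>c. cmod c \<ge> r \<Longrightarrow> B \<subseteq> (\<lambda>f x. c * f x) ` ?V"
    using assms unfolding bounded_subset_def by blast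
  show thesis
  proof (rule that[OF r(1)])
    fix f assume "f \<in> B"
    moreover have "B \<subseteq> (\<lambda>f x. complex_of_real r * f x) ` ?V"
      using r(1) by (intro r(2)) simp
    ultimately obtain h where h: "h \<in> ?V" "f = (\<lambda>x. complex_of_real r * h x)"
      by blast
    have "schwartz_seminorm k j f < r" if "k \<le> N" "j \<le> N" for k j
    proof -
      have "schwartz_seminorm k j f \<le> r * schwartz_seminorm k j h"
        using schwartz_seminorm_scale[of h k j "complex_of_real r"] h r(1) by simp
      also have "\<dots> < r * 1"
        using that h r(1) by (intro mult_strict_left_mono) auto
      finally show ?thesis by simp
    qed
    then show "\<forall>k\<le>N. \<forall>j\<le>N. schwartz_seminorm k j f < r" by blast
  qed
qed

section \<open>Constant multipliers\<close>

lemma weighted_comp_translation_funpow: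
  "(weighted_comp \<psi> (\<lambda>x. x + b) ^^ n) f =
     (\<lambda>x. (\<Prod>i<n. \<psi> (x + real i * b)) * f (x + real n * b))"
  \<comment> \<open>The innermost application is peeled off, which replaces \<open>f\<close> by its
    image; the new factor of the product then appears at index \<open>n\<close>.\<close>
  by (induction n arbitrary: f)
     (simp_all add: weighted_comp_def funpow_Suc_right algebra_simps del: funpow.simps)

lemma clinear_map_on_weighted_comp: "clinear_map_on S (weighted_comp \<psi> \<phi>)"
  by (auto simp: clinear_map_on_def weighted_comp_def algebra_simps)

lemma continuous_operator_shift:
  "continuous_operator schwartz (weighted_comp (\<lambda>_. a) (\<lambda>x. x + t))"
proof -
  let ?T = "weighted_comp (\<lambda>_. a) (\<lambda>x. x + t)"
  have T: "?T f \<in> schwartz_space" if "f \<in> schwartz_space" for f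
    using that by (simp add: weighted_comp_def schwartz_space_shift)
  have "openin schwartz {f \<in> schwartz_space. ?T f \<in> W}" if W: "openin schwartz W" for W
    unfolding openin_schwartz_iff
  proof (intro conjI ballI)
    fix f assume "f \<in> {f \<in> schwartz_space. ?T f \<in> W}"
    then have f: "f \<in> schwartz_space" "?T f \<in> W" by auto
    obtain N e where e: "e > 0" and sub: "\<forall>g\<in>schwartz_space.
        (\<forall>k\<le>N. \<forall>j\<le>N. schwartz_seminorm k j (\<lambda>x. g x - ?T f x) < e) \<longrightarrow> g \<in> W"
      using bspec[OF conjunct2[OF W[unfolded openin_schwartz_iff]] f(2)] by blast
    \<comment> \<open>A single constant dominates the factors of
      \<open>schwartz_seminorm_shift\<close> for all \<open>k \<le> N\<close>; the added 1 keeps it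
      positive even for \<open>a = 0\<close>. The 2 in the radius \<open>e / (2 * A)\<close>
      accounts for the two seminorms in that estimate.\<close>
    define A where "A = (\<Sum>k\<le>N. cmod a * 2 ^ k * (1 + \<bar>t\<bar> ^ k)) + 1"
    have A: "A > 0"
      unfolding A_def by (intro add_nonneg_pos sum_nonneg) auto
    have "?T g \<in> W" if g: "g \<in> schwartz_space"
      and less: "\<forall>k\<le>N. \<forall>j\<le>N. schwartz_seminorm k j (\<lambda>x. g x - f x) < e / (2 * A)" for g
    proof (rule bspec[OF sub, THEN mp])
      show "?T g \<in> schwartz_space" by (rule T[OF g])
      show "\<forall>k\<le>N. \<forall>j\<le>N. schwartz_seminorm k j (\<lambda>x. ?T g x - ?T f x) < e"
      proof (intro allI impI)
        fix k j assume kj: "k \<le> N" "j \<le> N"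
        let ?h = "\<lambda>x. g x - f x"
        have h: "?h \<in> schwartz_space"
          using f g by (simp add: schwartz_space_diff)
        have "cmod a * 2 ^ k * (1 + \<bar>t\<bar> ^ k) \<le> (\<Sum>k\<le>N. cmod a * 2 ^ k * (1 + \<bar>t\<bar> ^ k))"
          using kj by (intro member_le_sum) auto
        then have le: "cmod a * 2 ^ k * (1 + \<bar>t\<bar> ^ k) \<le> A"
          by (simp add: A_def)
        have "schwartz_seminorm k j (\<lambda>x. ?T g x - ?T f x)
            = schwartz_seminorm k j (\<lambda>x. a * ?h (x + t))"
          by (simp add: weighted_comp_def algebra_simps)
        also have "\<dots> \<le> cmod a * 2 ^ k * (1 + \<bar>t\<bar> ^ k) *
            (schwartz_seminorm k j ?h + schwartz_seminorm 0 j ?h)"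
          by (rule schwartz_seminorm_shift[OF h])
        also have "\<dots> \<le> A * (schwartz_seminorm k j ?h + schwartz_seminorm 0 j ?h)"
          using schwartz_seminorm_nonneg[OF h] by (intro mult_right_mono le add_nonneg_nonneg)
        also have "\<dots> < A * (e / (2 * A) + e / (2 * A))"
          using less[rule_format, of k j] less[rule_format, of 0 j] kj A
          by (intro mult_strict_left_mono add_strict_mono) auto
        also have "\<dots> = e"
          using A by simp
        finally show "schwartz_seminorm k j (\<lambda>x. ?T g x - ?T f x) < e" .
      qed
    qed
    then show "\<exists>N. \<exists>e>0. \<forall>g\<in>schwartz_space.
        (\<forall>k\<le>N. \<forall>j\<le>N. schwartz_seminorm k j (\<lambda>x. g x - f x) < e) \<longrightarrow>
        g \<in> {f \<in> schwartz_space. ?T f \<in> W}"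
      using A e by (intro exI[of _ N] exI[of _ "e / (2 * A)"]) auto
  qed auto
  then show ?thesis
    using T by (auto simp: continuous_operator_def clinear_map_on_weighted_comp
        continuous_map_def topspace_schwartz)
qed

section \<open>Decay of the seminorm factors and power boundedness for \<bar>c\<bar> < 1\<close>

lemma monomial_times_power_limit_0:
  fixes r :: real
  assumes "0 \<le> r" "r < 1"
  shows "(\<lambda>n. real n ^ k * r ^ n) \<longlonglongrightarrow> 0"
  using assms
proof (induction k arbitrary: r)
  case 0
  then show ?case by (simp add: LIMSEQ_power_zero)
next
  case (Suc k)
  \<comment> \<open>Half of the geometric decay is spent on one factor \<open>n\<close>, the other
    half on the remaining power. The induction hypothesis is used at \<open>sqrt r\<close>, hence
    the generalization over \<open>r\<close>.\<close>
  have "(\<lambda>n. (real n * sqrt r ^ n) * (real n ^ k * sqrt r ^ n)) \<longlonglongrightarrow> 0 * 0"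
    using Suc by (intro tendsto_mult powser_times_n_limit_0 Suc.IH) auto
  moreover have "(real n * sqrt r ^ n) * (real n ^ k * sqrt r ^ n) = real n ^ Suc k * r ^ n" for n
  proof -
    have "sqrt r ^ n * sqrt r ^ n = r ^ n"
      using Suc.prems by (simp flip: power_mult_distrib)
    then show ?thesis by (simp add: mult_ac)
  qed
  ultimately show ?case by simp
qed

lemma shift_seminorm_uniform_limit:
  assumes c: "cmod c < 1" and "d > 0"
  shows "\<forall>\<^sub>F n in sequentially. \<forall>k\<le>N. cmod (c ^ n) * 2 ^ k * (1 + \<bar>real n * b\<bar> ^ k) < d"
proof -
  have "(\<lambda>n. cmod (c ^ n) * 2 ^ k * (1 + \<bar>real n * b\<bar> ^ k)) \<longlonglongrightarrow> 0" for k
  proof -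
    have "(\<lambda>n. real n ^ k * cmod c ^ n) \<longlonglongrightarrow> 0" "(\<lambda>n. cmod c ^ n) \<longlonglongrightarrow> 0"
      using c by (auto intro: monomial_times_power_limit_0 LIMSEQ_power_zero)
    then have "(\<lambda>n. 2 ^ k * (cmod c ^ n + \<bar>b\<bar> ^ k * (real n ^ k * cmod c ^ n))) \<longlonglongrightarrow>
        2 ^ k * (0 + \<bar>b\<bar> ^ k * 0)"
      by (intro tendsto_mult tendsto_add tendsto_const)
    then show ?thesis
      by (simp add: norm_power abs_mult power_mult_distrib algebra_simps)
  qed
  then have "\<forall>\<^sub>F n in sequentially. cmod (c ^ n) * 2 ^ k * (1 + \<bar>real n * b\<bar> ^ k) < d" for k
    using \<open>d > 0\<close> by (rule order_tendstoD(2))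
  \<comment> \<open>Finitely many \<open>k\<close> allow one threshold for \<open>n\<close> to serve
    them all.\<close>
  then have "\<forall>\<^sub>F n in sequentially.
      \<forall>k\<in>{..N}. cmod (c ^ n) * 2 ^ k * (1 + \<bar>real n * b\<bar> ^ k) < d"
    by (intro eventually_ball_finite) auto
  then show ?thesis
    by (rule eventually_mono) simp
qed

text \<open>Powers stay within the class of constant multiples of translations, so the estimates for
  a single such operator apply to every power.\<close>

lemma funpow_shift:
  "weighted_comp (\<lambda>_. c) (\<lambda>x. x + b) ^^ n = weighted_comp (\<lambda>_. c ^ n) (\<lambda>x. x + real n * b)"
  by (rule ext) (simp add: weighted_comp_translation_funpow, simp add: weighted_comp_def)

lemma equicontinuous_shift_powers:
  assumes c: "cmod c < 1"
  shows "equicontinuous_family schwartz {weighted_comp (\<lambda>_. c) (\<lambda>x. x + b) ^^ n | n. True}"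
  unfolding equicontinuous_family_def
proof (intro ballI allI impI)
  let ?T = "\<lambda>n. weighted_comp (\<lambda>_. c) (\<lambda>x. x + b) ^^ n"
  fix f V assume "nhd0 schwartz V"
  then obtain N e where e: "e > 0" and sub: "\<And>f. f \<in> schwartz_space \<Longrightarrow>
      \<forall>k\<le>N. \<forall>j\<le>N. schwartz_seminorm k j f < e \<Longrightarrow> f \<in> V"
    by (rule nhd0_schwartzE) blast
  let ?a = "\<lambda>n k. cmod (c ^ n) * 2 ^ k * (1 + \<bar>real n * b\<bar> ^ k)"
  obtain n0 where n0: "\<And>n k. n \<ge> n0 \<Longrightarrow> k \<le> N \<Longrightarrow> ?a n k < 1"
    using shift_seminorm_uniform_limit[OF c, of 1 N b] by (auto simp: eventually_sequentially)
  \<comment> \<open>A bound uniform in \<open>n\<close>: the summand 1 covers the tail, where the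
    factors are already below 1, and the finite sum covers the initial powers.\<close>
  define A where "A = (\<Sum>(n,k)\<in>{..n0} \<times> {..N}. ?a n k) + 1"
  have nonneg: "(\<Sum>(n,k)\<in>{..n0} \<times> {..N}. ?a n k) \<ge> 0"
    by (intro sum_nonneg) auto
  then have A: "A > 0"
    by (simp add: A_def)
  have le: "?a n k \<le> A" if "k \<le> N" for n k
  proof (cases "n \<ge> n0")
    case True
    then show ?thesis
      using n0[OF True that] nonneg by (simp add: A_def)
  next
    case False
    have "(case (n, k) of (n, k) \<Rightarrow> ?a n k) \<le> (\<Sum>(n,k)\<in>{..n0} \<times> {..N}. ?a n k)"
      using False that by (intro member_le_sum) auto
    then show ?thesis
      by (simp add: A_def)
  qed
  let ?U = "{h \<in> schwartz_space. \<forall>k\<le>N. \<forall>j\<le>N. schwartz_seminorm k j h < e / (2 * A)}"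
  have "(\<lambda>x. ?T n g x - ?T n f x) \<in> V" if "(\<lambda>x. g x - f x) \<in> ?U" for n g
  proof -
    let ?h = "\<lambda>x. g x - f x"
    have h: "?h \<in> schwartz_space" using that by simp
    have "(\<lambda>x. c ^ n * ?h (x + real n * b)) \<in> V"
    proof (intro sub schwartz_space_shift[OF h] allI impI)
      fix k j assume kj: "k \<le> N" "j \<le> N"
      have "schwartz_seminorm k j (\<lambda>x. c ^ n * ?h (x + real n * b)) \<le>
          ?a n k * (schwartz_seminorm k j ?h + schwartz_seminorm 0 j ?h)"
        by (rule schwartz_seminorm_shift[OF h])
      also have "\<dots> \<le> A * (schwartz_seminorm k j ?h + schwartz_seminorm 0 j ?h)"
        using schwartz_seminorm_nonneg[OF h]
        by (intro mult_right_mono le[OF kj(1)] add_nonneg_nonneg)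
      also have "\<dots> < A * (e / (2 * A) + e / (2 * A))"
        using that kj A by (intro mult_strict_left_mono add_strict_mono) auto
      also have "\<dots> = e"
        using A by simp
      finally show "schwartz_seminorm k j (\<lambda>x. c ^ n * ?h (x + real n * b)) < e" .
    qed
    moreover have "(\<lambda>x. ?T n g x - ?T n f x) = (\<lambda>x. c ^ n * ?h (x + real n * b))"
      unfolding funpow_shift weighted_comp_def by (simp add: algebra_simps)
    ultimately show ?thesis by simp
  qed
  moreover have "nhd0 schwartz ?U"
    using e A by (intro nhd0_schwartz_ball) simp
  ultimately show "\<exists>U. nhd0 schwartz U \<and> (\<forall>S\<in>{?T n | n. True}. \<forall>g\<in>topspace schwartz.
      (\<lambda>x. g x - f x) \<in> U \<longrightarrow> (\<lambda>x. S g x - S f x) \<in> V)"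
    by blast
qed

lemma power_bounded_shift:
  assumes "cmod c < 1"
  shows "power_bounded schwartz (weighted_comp (\<lambda>_. c) (\<lambda>x. x + b))"
  unfolding power_bounded_def
  using continuous_operator_shift equicontinuous_shift_powers[OF assms] by blast

section \<open>Convergence to zero uniformly on bounded sets\<close>

lemma continuous_operator_restrict:
  assumes "continuous_operator schwartz T"
  shows "restrict T (topspace schwartz) \<in> operators schwartz"
proof -
  have "continuous_map schwartz schwartz (restrict T (topspace schwartz))"
    using assms by (auto simp: continuous_operator_def intro: continuous_map_eq)
  \<comment> \<open>Linearity of the restriction evaluates it at sums and multiples; these must lie
    in the carrier, where it agrees with \<open>T\<close>.\<close>
  moreover have "(\<lambda>x. f x + g x) \<in> schwartz_space" "(\<lambda>x. a * f x) \<in> schwartz_space"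
    if "f \<in> schwartz_space" "g \<in> schwartz_space" for f g a
    using that schwartz_space_shift[of f a 0] by (auto simp: schwartz_space_add)
  ultimately show ?thesis
    using assms
    by (auto simp: operators_def continuous_operator_def clinear_map_on_def topspace_schwartz)
qed

lemma limitin_shift_powers:
  assumes c: "cmod c < 1"
  shows "limitin (Lb_topology schwartz)
    (\<lambda>n. restrict (weighted_comp (\<lambda>_. c) (\<lambda>x. x + b) ^^ n) (topspace schwartz))
    (restrict (\<lambda>f x. 0) (topspace schwartz)) sequentially"
  unfolding limitin_def
proof (intro conjI allI impI)
  let ?T = "\<lambda>n. restrict (weighted_comp (\<lambda>_. c) (\<lambda>x. x + b) ^^ n) (topspace schwartz)"
  let ?Z = "restrict (\<lambda>f x. 0) (topspace schwartz) :: (real \<Rightarrow> complex) \<Rightarrow> real \<Rightarrow> complex"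
  \<comment> \<open>The zero operator is viewed as a degenerate shift, so that its continuity comes
    from the general result.\<close>
  have "weighted_comp (\<lambda>_. 0) (\<lambda>x. x + 0) = (\<lambda>f x. 0)"
    by (auto simp: weighted_comp_def)
  then have Z: "?Z \<in> operators schwartz"
    using continuous_operator_restrict[OF continuous_operator_shift[of 0 0]] by simp
  \<comment> \<open>The empty bounded set imposes no condition, so the set of all operators is open
    and the limit lies in the space.\<close>
  have "bounded_subset schwartz {}" "nhd0 schwartz (topspace schwartz)"
    using schwartz_space_zero
    by (auto simp: bounded_subset_def nhd0_def topspace_schwartz intro: exI[of _ 1])
      (metis openin_topspace topspace_schwartz)
  then have "openin (Lb_topology schwartz) (operators schwartz)"
    unfolding openin_Lb_topology openin_Lb_def by blast
  then show "?Z \<in> topspace (Lb_topology schwartz)"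
    using Z openin_subset by blast
  fix W assume "openin (Lb_topology schwartz) W \<and> ?Z \<in> W"
  then obtain B V where B: "bounded_subset schwartz B" and V: "nhd0 schwartz V"
    and W: "{R \<in> operators schwartz. \<forall>f\<in>B. (\<lambda>x. R f x - ?Z f x) \<in> V} \<subseteq> W"
    unfolding openin_Lb_topology openin_Lb_def by meson
  obtain N e where e: "e > 0" and sub: "\<And>f. f \<in> schwartz_space \<Longrightarrow>
      \<forall>k\<le>N. \<forall>j\<le>N. schwartz_seminorm k j f < e \<Longrightarrow> f \<in> V"
    by (rule nhd0_schwartzE[OF V]) blast
  obtain M where M: "M > 0" "\<And>f. f \<in> B \<Longrightarrow> \<forall>k\<le>N. \<forall>j\<le>N. schwartz_seminorm k j f < M"
    by (rule bounded_subset_schwartzD[OF B]) blast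
  let ?a = "\<lambda>n k. cmod (c ^ n) * 2 ^ k * (1 + \<bar>real n * b\<bar> ^ k)"
  \<comment> \<open>Both seminorms in the shift estimate are below \<open>M\<close> for every
    \<open>f\<close> in \<open>B\<close>, so this threshold is uniform over
    \<open>B\<close>.\<close>
  have "\<forall>\<^sub>F n in sequentially. \<forall>k\<le>N. ?a n k < e / (2 * M)"
    using e M by (intro shift_seminorm_uniform_limit[OF c]) auto
  then show "\<forall>\<^sub>F n in sequentially. ?T n \<in> W"
  proof eventually_elim
    fix n assume n: "\<forall>k\<le>N. ?a n k < e / (2 * M)"
    have "?T n \<in> operators schwartz"
      unfolding funpow_shift by (intro continuous_operator_restrict continuous_operator_shift)
    moreover have "(\<lambda>x. ?T n f x - ?Z f x) \<in> V" if f: "f \<in> B" for f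
    proof -
      have fS: "f \<in> schwartz_space"
        using f B by (auto simp: bounded_subset_def topspace_schwartz)
      have "(\<lambda>x. c ^ n * f (x + real n * b)) \<in> V"
      proof (intro sub schwartz_space_shift[OF fS] allI impI)
        fix k j assume kj: "k \<le> N" "j \<le> N"
        have "schwartz_seminorm k j (\<lambda>x. c ^ n * f (x + real n * b)) \<le>
            ?a n k * (schwartz_seminorm k j f + schwartz_seminorm 0 j f)"
          by (rule schwartz_seminorm_shift[OF fS])
        also have "\<dots> \<le> ?a n k * (M + M)"
          using M(2)[OF f] kj by (intro mult_left_mono add_mono) (auto intro: less_imp_le)
        also have "\<dots> < e / (2 * M) * (M + M)"
          using n kj M(1) by (intro mult_strict_right_mono) auto
        also have "\<dots> = e"
          using M(1) by simp
        finally show "schwartz_seminorm k j (\<lambda>x. c ^ n * f (x + real n * b)) < e" .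
      qed
      moreover have "(\<lambda>x. ?T n f x - ?Z f x) = (\<lambda>x. c ^ n * f (x + real n * b))"
        using fS by (simp add: funpow_shift topspace_schwartz weighted_comp_def)
      ultimately show ?thesis by simp
    qed
    ultimately show "?T n \<in> W"
      using W by blast
  qed
qed

section \<open>The Gaussian and unbounded orbits\<close>

text \<open>Splitting off the constant coefficient leaves \<open>x\<close> times a shorter
  polynomial, and that \<open>x\<close> is absorbed into the weight. The induction hypothesis is
  therefore needed at exponent \<open>Suc k\<close>.\<close>

lemma poly_times_gaussian_bounded:
  fixes p :: "real poly"
  shows "\<exists>B. \<forall>x. \<bar>x\<bar> ^ k * \<bar>poly p x * exp (- (x\<^sup>2))\<bar> \<le> B"
proof (induction p arbitrary: k)
  case 0
  then show ?case by (auto intro: exI[of _ 0])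
next
  case (pCons a p)
  obtain B where B: "\<And>x. \<bar>x\<bar> ^ Suc k * \<bar>poly p x * exp (- (x\<^sup>2))\<bar> \<le> B"
    using pCons.IH[of "Suc k"] by blast
  \<comment> \<open>Passing to even powers bounds the monomial by 1 plus a power of
    \<open>x\<^sup>2\<close>, and that power is, up to \<open>fact k\<close>, a single term of the
    series of \<open>exp (x\<^sup>2)\<close>.\<close>
  have monom: "\<bar>x\<bar> ^ k * exp (- (x\<^sup>2)) \<le> 1 + fact k" for x :: real
  proof -
    have "\<bar>x\<bar> ^ k \<le> 1 + (x\<^sup>2) ^ k"
    proof (cases "\<bar>x\<bar> \<le> 1")
      case True
      then show ?thesis by (simp add: power_le_one add_increasing2)
    next
      case False
      then have "\<bar>x\<bar> ^ k \<le> \<bar>x\<bar> ^ (2 * k)"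
        by (intro power_increasing) auto
      also have "\<dots> = (x\<^sup>2) ^ k"
        by (simp add: power_mult)
      finally show ?thesis by simp
    qed
    also have "\<dots> \<le> exp (x\<^sup>2) + fact k * exp (x\<^sup>2)"
    proof (intro add_mono)
      show "(x\<^sup>2) ^ k \<le> fact k * exp (x\<^sup>2)"
      proof -
        have "(x\<^sup>2) ^ k /\<^sub>R fact k \<le> (\<Sum>n. (x\<^sup>2) ^ n /\<^sub>R fact n)"
          using sum_le_suminf[OF summable_exp_generic[of "x\<^sup>2"], of "{k}"] by simp
        then show ?thesis
          by (simp add: exp_def field_simps)
      qed
    qed simp
    finally show ?thesis
      by (simp add: exp_minus field_simps)
  qed
  have "\<bar>x\<bar> ^ k * \<bar>poly (pCons a p) x * exp (- (x\<^sup>2))\<bar> \<le> \<bar>a\<bar> * (1 + fact k) + B" for x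
  proof -
    have "\<bar>poly (pCons a p) x\<bar> \<le> \<bar>a\<bar> + \<bar>x\<bar> * \<bar>poly p x\<bar>"
      by (simp add: abs_triangle_ineq[THEN order_trans] abs_mult)
    then have "\<bar>x\<bar> ^ k * \<bar>poly (pCons a p) x * exp (- (x\<^sup>2))\<bar>
        \<le> \<bar>x\<bar> ^ k * ((\<bar>a\<bar> + \<bar>x\<bar> * \<bar>poly p x\<bar>) * exp (- (x\<^sup>2)))"
      unfolding abs_mult abs_exp_cancel by (intro mult_left_mono mult_right_mono) auto
    also have "\<dots> = \<bar>a\<bar> * (\<bar>x\<bar> ^ k * exp (- (x\<^sup>2))) + \<bar>x\<bar> ^ Suc k * \<bar>poly p x * exp (- (x\<^sup>2))\<bar>"
      by (simp add: abs_mult algebra_simps)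
    also have "\<dots> \<le> \<bar>a\<bar> * (1 + fact k) + B"
      by (intro add_mono mult_left_mono monom B) auto
    finally show ?thesis .
  qed
  then show ?case by blast
qed

lemma gaussian_schwartz: "(\<lambda>x. complex_of_real (exp (- (x\<^sup>2)))) \<in> schwartz_space"
proof -
  \<comment> \<open>Differentiating p(x) exp(-x^2) multiplies the Gaussian by p' - 2xp instead of p.
    Up to sign these are the Hermite polynomials.\<close>
  define P :: "nat \<Rightarrow> real poly" where "P j = ((\<lambda>p. pderiv p - [:0, 2:] * p) ^^ j) 1" for j
  define D where "D j x = complex_of_real (poly (P j) x * exp (- (x\<^sup>2)))" for j x
  have D: "(D j has_vector_derivative D (Suc j) x) (at x)" for j x
  proof -
    have "((\<lambda>x. poly (P j) x * exp (- (x\<^sup>2))) has_real_derivative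
        poly (P (Suc j)) x * exp (- (x\<^sup>2))) (at x)"
      by (auto intro!: derivative_eq_intros poly_DERIV simp: P_def algebra_simps power2_eq_square)
    then show ?thesis
      unfolding D_def by (rule has_vector_derivative_of_real)
  qed
  have D0: "D 0 = (\<lambda>x. complex_of_real (exp (- (x\<^sup>2))))"
    by (auto simp: D_def P_def)
  have "D 0 \<in> schwartz_space"
    unfolding schwartz_space_iff nderiv_eqI[of D, OF D]
    using smoothI[of D, OF D] poly_times_gaussian_bounded
    by (auto simp: D_def simp del: of_real_mult)
  then show ?thesis by (simp add: D0)
qed

section \<open>Bounded orbits and their consequence for polynomial multipliers\<close>

lemma power_bounded_orbit_bounded:
  assumes pb: "power_bounded schwartz (weighted_comp \<psi> \<phi>)" and g: "g \<in> schwartz_space"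
  obtains C where "\<And>n x. \<bar>x\<bar> * cmod ((weighted_comp \<psi> \<phi> ^^ n) g x) \<le> C"
proof -
  let ?T = "weighted_comp \<psi> \<phi>"
  have scale: "(?T ^^ n) (\<lambda>x. a * f x) = (\<lambda>x. a * (?T ^^ n) f x)" for n a f
    by (induction n) (simp_all add: weighted_comp_def algebra_simps)
  have zero: "(?T ^^ n) (\<lambda>x. 0) = (\<lambda>x. 0)" for n
    using scale[of n 0 "\<lambda>x. 0"] by simp
  \<comment> \<open>The indices up to 1 include the seminorm with weight \<bar>x\<bar> and no
    derivative, which gives the bound in the conclusion.\<close>
  let ?V = "{f \<in> schwartz_space. \<forall>k\<le>1. \<forall>j\<le>1. schwartz_seminorm k j f < 1}"
  have "nhd0 schwartz ?V"
    by (rule nhd0_schwartz_ball) simp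
  moreover have "equicontinuous_family schwartz {?T ^^ n | n. True}"
    using pb by (simp add: power_bounded_def)
  \<comment> \<open>Equicontinuity is used at the zero function, which every power fixes.\<close>
  ultimately obtain U where U: "nhd0 schwartz U"
    and 1: "\<forall>S\<in>{?T ^^ n | n. True}. \<forall>h\<in>topspace schwartz.
      (\<lambda>x. h x - 0) \<in> U \<longrightarrow> (\<lambda>x. S h x - S (\<lambda>x. 0) x) \<in> ?V"
    unfolding equicontinuous_family_def topspace_schwartz
    using schwartz_space_zero by (elim ballE[of _ _ "\<lambda>x. 0"] allE[of _ ?V]) blast+
  have UV: "(?T ^^ n) h \<in> ?V" if "h \<in> schwartz_space" "h \<in> U" for n h
  proof -
    have "?T ^^ n \<in> {?T ^^ n | n. True}" "h \<in> topspace schwartz"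
      using that by (auto simp: topspace_schwartz)
    from bspec[OF bspec[OF 1 this(1)] this(2)] that(2) show ?thesis
      by (simp add: zero)
  qed
  obtain N e where e: "e > 0" and sub: "\<And>f. f \<in> schwartz_space \<Longrightarrow>
      \<forall>k\<le>N. \<forall>j\<le>N. schwartz_seminorm k j f < e \<Longrightarrow> f \<in> U"
    by (rule nhd0_schwartzE[OF U]) blast
  define A where "A = (\<Sum>(k, j)\<in>{..N} \<times> {..N}. schwartz_seminorm k j g) + 1"
  have A: "A > 0"
    unfolding A_def by (intro add_nonneg_pos sum_nonneg) (auto simp: schwartz_seminorm_nonneg g)
  \<comment> \<open>A multiple of \<open>g\<close> small enough to lie in \<open>U\<close>, since
    \<open>A\<close> exceeds all relevant seminorms of \<open>g\<close>. Undoing the scaling at the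
    end produces the orbit bound \<open>A / e\<close>.\<close>
  let ?h = "\<lambda>x. complex_of_real (e / A) * g x"
  have h: "?h \<in> schwartz_space"
    using schwartz_space_shift[OF g, of "complex_of_real (e / A)" 0] by simp
  have "?h \<in> U"
  proof (intro sub h allI impI)
    fix k j assume kj: "k \<le> N" "j \<le> N"
    have "(case (k, j) of (k, j) \<Rightarrow> schwartz_seminorm k j g) \<le>
        (\<Sum>(k, j)\<in>{..N} \<times> {..N}. schwartz_seminorm k j g)"
      using kj by (intro member_le_sum) (auto simp: schwartz_seminorm_nonneg g)
    then have less: "schwartz_seminorm k j g < A"
      by (simp add: A_def)
    have "schwartz_seminorm k j ?h \<le> e / A * schwartz_seminorm k j g"
      using schwartz_seminorm_scale[OF g, of k j "complex_of_real (e / A)"] e A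
      by (simp add: norm_divide)
    also have "\<dots> < e / A * A"
      using less e A by (intro mult_strict_left_mono) auto
    also have "\<dots> = e"
      using A by simp
    finally show "schwartz_seminorm k j ?h < e" .
  qed
  then have V: "(?T ^^ n) ?h \<in> ?V" for n
    by (rule UV[OF h])
  show thesis
  proof (rule that)
    fix n x
    have "\<bar>x\<bar> ^ 1 * cmod (nderiv 0 ((?T ^^ n) ?h) x) \<le> schwartz_seminorm 1 0 ((?T ^^ n) ?h)"
      using V[of n] by (intro le_schwartz_seminorm) auto
    also have "\<dots> \<le> 1"
      using V[of n] by (auto intro: less_imp_le)
    finally have "\<bar>x\<bar> * (e / A * cmod ((?T ^^ n) g x)) \<le> 1"
      using e A unfolding scale by (simp add: norm_mult norm_divide)
    then show "\<bar>x\<bar> * cmod ((?T ^^ n) g x) \<le> A / e"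
      using e A by (simp add: field_simps)
  qed
qed

text \<open>Either the polynomial is a constant of modulus at least 1, or its modulus tends to
  infinity and a progression that stays far from the origin suffices.\<close>

lemma poly_ge_1_along_progression:
  fixes p :: "complex poly" and b :: real
  assumes "b \<noteq> 0" "\<not> (\<exists>c. cmod c < 1 \<and> (\<forall>x::real. poly p (complex_of_real x) = c))"
  obtains y :: real where "\<And>i. cmod (poly p (complex_of_real (y - real i * b))) \<ge> 1"
proof (cases p)
  case (pCons a q)
  show thesis
  proof (cases "q = 0")
    case True
    then have "cmod a \<ge> 1"
      using assms(2) pCons by auto
    then show thesis
      using True pCons that by simp
  next
    case False
    then obtain r where r: "\<And>z. r \<le> cmod z \<Longrightarrow> 1 \<le> cmod (poly p z)"
      using poly_infinity[of q 1 a] pCons by auto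
    show thesis
    proof (rule that, rule r)
      fix i
      \<comment> \<open>The start \<open>- \<bar>r\<bar> * sgn b\<close> has sign opposite to
        \<open>b\<close>, so each subtraction of \<open>b\<close> moves further from the
        origin.\<close>
      have "\<bar>- \<bar>r\<bar> * sgn b - real i * b\<bar> = \<bar>r\<bar> + real i * \<bar>b\<bar>"
      proof -
        have "- \<bar>r\<bar> * sgn b - real i * b = - sgn b * (\<bar>r\<bar> + real i * \<bar>b\<bar>)"
          by (simp add: abs_sgn algebra_simps sgn_if)
        then show ?thesis
          using assms(1) by (auto simp: abs_mult abs_sgn_eq)
      qed
      then show "r \<le> cmod (complex_of_real (- \<bar>r\<bar> * sgn b - real i * b))"
        unfolding norm_of_real by (simp add: add_increasing2)
    qed
  qed
qed

lemma power_bounded_imp_constant: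
  fixes p :: "complex poly" and b :: real
  assumes b: "b \<noteq> 0"
    and pb: "power_bounded schwartz (weighted_comp (\<lambda>x. poly p (complex_of_real x)) (\<lambda>x. x + b))"
  shows "\<exists>c. cmod c < 1 \<and> (\<forall>x::real. poly p (complex_of_real x) = c)"
proof (rule ccontr)
  assume "\<not> ?thesis"
  then obtain y where y: "\<And>i. cmod (poly p (complex_of_real (y - real i * b))) \<ge> 1"
    using poly_ge_1_along_progression[OF b] by blast
  let ?\<psi> = "\<lambda>x. poly p (complex_of_real x)"
  obtain C where C: "\<And>n x. \<bar>x\<bar> *
      cmod ((weighted_comp ?\<psi> (\<lambda>x. x + b) ^^ n) (\<lambda>x. complex_of_real (exp (- (x\<^sup>2)))) x) \<le> C"
    using power_bounded_orbit_bounded[OF pb gaussian_schwartz] by blast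
  have le: "\<bar>y - real n * b\<bar> * exp (- (y\<^sup>2)) \<le> C" for n
  proof -
    \<comment> \<open>The product runs through the progression backwards: its factor
      \<open>i\<close> sits at the progression index \<open>n - i\<close>.\<close>
    have "1 \<le> cmod (?\<psi> (y - real n * b + real i * b))" if "i < n" for i
      using y[of "n - i"] that by (simp add: of_nat_diff algebra_simps)
    then have "1 \<le> (\<Prod>i<n. cmod (?\<psi> (y - real n * b + real i * b)))"
      by (intro prod_ge_1) auto
    then have "1 * exp (- (y\<^sup>2)) \<le>
        (\<Prod>i<n. cmod (?\<psi> (y - real n * b + real i * b))) * exp (- (y\<^sup>2))"
      by (intro mult_right_mono) auto
    then have "\<bar>y - real n * b\<bar> * exp (- (y\<^sup>2)) \<le> \<bar>y - real n * b\<bar> *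
        ((\<Prod>i<n. cmod (?\<psi> (y - real n * b + real i * b))) * exp (- (y\<^sup>2)))"
      by (intro mult_left_mono) auto
    also have "\<dots> \<le> C"
      using C[of "y - real n * b" n] unfolding weighted_comp_translation_funpow norm_mult
      by (simp add: prod_norm del: of_real_add of_real_diff of_real_mult)
    finally show ?thesis .
  qed
  \<comment> \<open>Chosen so that \<open>\<bar>y - real n * b\<bar>\<close>, which is at least
    \<open>real n * \<bar>b\<bar> - \<bar>y\<bar>\<close>, exceeds
    \<open>C * exp (y\<^sup>2)\<close>.\<close>
  obtain n :: nat where n: "real n > (\<bar>y\<bar> + C * exp (y\<^sup>2)) / \<bar>b\<bar>"
    using reals_Archimedean2 by blast
  then have "\<bar>y\<bar> + C * exp (y\<^sup>2) < real n * \<bar>b\<bar>"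
    using b by (simp add: field_simps)
  also have "\<dots> = \<bar>real n * b\<bar>"
    by (simp add: abs_mult)
  also have "\<dots> \<le> \<bar>y\<bar> + \<bar>y - real n * b\<bar>"
    by linarith
  finally show False
    using le[of n] by (simp add: exp_minus field_simps)
qed

theorem proposition5p3:
  fixes b :: real and \<phi> :: "real \<Rightarrow> real" and \<psi> :: "real \<Rightarrow> complex"
  assumes "b \<noteq> 0"
    and "\<phi> = (\<lambda>x. x + b)"
    and "\<exists>p :: complex poly. \<forall>x. \<psi> x = poly p (complex_of_real x)"
  shows "(power_bounded schwartz (weighted_comp \<psi> \<phi>) \<longleftrightarrow>
            (\<exists>c :: complex. cmod c < 1 \<and> (\<forall>x. \<psi> x = c))) \<and>
         (power_bounded schwartz (weighted_comp \<psi> \<phi>) \<longrightarrow>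
            limitin (Lb_topology schwartz)
              (\<lambda>n. restrict (weighted_comp \<psi> \<phi> ^^ n) (topspace schwartz))
              (restrict (\<lambda>f x. 0) (topspace schwartz)) sequentially)"
proof -
  obtain p :: "complex poly" where p: "\<psi> = (\<lambda>x. poly p (complex_of_real x))"
    using assms(3) by blast
  \<comment> \<open>An equation between functions lets the multiplier be replaced inside
    \<open>weighted_comp\<close>, as the convergence result requires.\<close>
  have const: "\<exists>c. cmod c < 1 \<and> \<psi> = (\<lambda>_. c)"
    if "power_bounded schwartz (weighted_comp \<psi> \<phi>)"
    using power_bounded_imp_constant[OF assms(1)] that unfolding p assms(2) by blast
  have bounded: "power_bounded schwartz (weighted_comp \<psi> \<phi>)" if "cmod c < 1" "\<forall>x. \<psi> x = c" for c
  proof -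
    have "\<psi> = (\<lambda>_. c)" using that(2) by blast
    then show ?thesis
      using power_bounded_shift[OF that(1)] assms(2) by simp
  qed
  show ?thesis
    using const bounded limitin_shift_powers unfolding assms(2) by blast
qed

end
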